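(* Let $G$ be a graph. Then $\operatorname{Z}_\ell(G)=1$ if and only if $G$ is a caterpillar. Furthermore, for a coupled graph $G^{\mathfrak C}$, $\operatorname{Z}_{\operatorname{C}}(G^{\mathfrak C})=1$ if and only if $G(\mathfrak C)$ is a caterpillar that contains a perfect matching. If $G$ is connected, then $\operatorname{Z}_{\operatorname{C}}(G^{\mathfrak C})=1$ if and only if $G$ is a caterpillar that contains a perfect matching $M$ and $\mathfrak C$ is the coupling defined by $M$.
   Context: Graphs are simple, undirected, finite, with nonempty vertex set. A caterpillar is a tree $T$ that has a path $P$ such that every other vertex of $T$ is adjacent to a vertex of $P$. Loop zero forcing on $G$: each vertex is blue or white; (1) if $u$ is blue and exactly one neighbor $w$ of $u$ is white, then $w$ becomes blue; (2) if $w$ is white, $w$ is not an isolated vertex, and every neighbor of $w$ is blue, then $w$ becomes blue. $\operatorname{Z}_\ell(G)$ is the minimum cardinality of a set of initially blue vertices from which repeated application of this rule colors all vertices blue. A coupled graph $G^{\mathfrak C}$ is a graph $G$ of order $2p$ together with a coupling $\mathfrak C$, i.e. a partition of $V(G)$ into $p$ unordered pairs (paired vertices need not be adjacent); $\mathfrak c(v)$ is the vertex paired with $v$. $G(\mathfrak C)$ is the simple graph obtained from $G$ by adding, if not already present, an edge between $v$ and $\mathfrak c(v)$ for each pair of coupled vertices. If $M$ is a perfect matching of $G$, the coupling defined by $M$ consists of the pairs of endpoints of the edges of $M$. Coupled zero forcing on $G^{\mathfrak C}$: (1) a blue vertex $v$ forces a white vertex $w$ to become blue if $w$ is the only white vertex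 in $N(v)\cup\{\mathfrak c(v)\}$; (2) a white vertex $v$ becomes blue if every vertex in $N(v)\cup\{\mathfrak c(v)\}$ is blue ($N(v)$ is the open neighborhood in $G$). $\operatorname{Z}_{\operatorname{C}}(G^{\mathfrak C})$ is the minimum cardinality of a set of initially blue vertices from which repeated application of this rule colors all vertices blue. *)

theory Defs
  imports
    "Graph_Theory.Pair_Digraph"
    "Graph_Theory.Digraph_Component"
    "Graph_Theory.Vertex_Walk"
    "HOL-Library.Disjoint_Sets"
begin

(* A finite simple undirected graph is a pair_graph: an edge between u and v is
   the pair of opposite arcs (u, v) and (v, u). *)

definition nbhd :: "'a pair_pre_digraph \<Rightarrow> 'a \<Rightarrow> 'a set" where
  "nbhd G v = {w. (v, w) \<in> parcs G}"

definition edges :: "'a pair_pre_digraph \<Rightarrow> 'a set set" where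
  "edges G = {{u, v} | u v. (u, v) \<in> parcs G}"

(* The library's forest and tree cannot be used here: they count the two opposite
   arcs of a single edge as a cycle. The cycles of an undirected simple graph
   are the directed cycles of length at least 3. *)
definition undirected_tree :: "'a pair_pre_digraph \<Rightarrow> bool" where
  "undirected_tree G \<longleftrightarrow>
     Digraph_Component.connected (with_proj G) \<and>
     \<not> (\<exists>p. pre_digraph.cycle (with_proj G) p \<and> length p \<ge> 3)"

definition caterpillar :: "'a pair_pre_digraph \<Rightarrow> bool" where
  "caterpillar T \<longleftrightarrow>
     undirected_tree T \<and>
     (\<exists>P. vpath P (with_proj T) \<and>
       (\<forall>v \<in> pverts T - set P. \<exists>w \<in> set P. (v, w) \<in> parcs T))"


inductive loop_step :: "'a pair_pre_digraph \<Rightarrow> 'a set \<Rightarrow> 'a set \<Rightarrow> bool"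
  for G :: "'a pair_pre_digraph" where
  force: "u \<in> B \<Longrightarrow> nbhd G u - B = {w} \<Longrightarrow> loop_step G B (insert w B)"
| self: "w \<in> pverts G - B \<Longrightarrow> nbhd G w \<noteq> {} \<Longrightarrow> nbhd G w \<subseteq> B \<Longrightarrow> loop_step G B (insert w B)"

definition loop_zero_forcing_set :: "'a pair_pre_digraph \<Rightarrow> 'a set \<Rightarrow> bool" where
  "loop_zero_forcing_set G B \<longleftrightarrow> B \<subseteq> pverts G \<and> (loop_step G)\<^sup>*\<^sup>* B (pverts G)"

definition loop_zero_forcing_number :: "'a pair_pre_digraph \<Rightarrow> nat" where
  "loop_zero_forcing_number G = (LEAST k. \<exists>B. loop_zero_forcing_set G B \<and> card B = k)"


definition is_coupling :: "'a pair_pre_digraph \<Rightarrow> 'a set set \<Rightarrow> bool" where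
  "is_coupling G C \<longleftrightarrow> partition_on (pverts G) C \<and> (\<forall>P \<in> C. card P = 2)"

definition partner :: "'a set set \<Rightarrow> 'a \<Rightarrow> 'a" where
  "partner C v = (THE w. {v, w} \<in> C)"

definition add_coupling :: "'a pair_pre_digraph \<Rightarrow> 'a set set \<Rightarrow> 'a pair_pre_digraph" where
  "add_coupling G C =
     \<lparr> pverts = pverts G,
       parcs = parcs G \<union> {(v, partner C v) | v. v \<in> pverts G} \<union> {(partner C v, v) | v. v \<in> pverts G} \<rparr>"

(* Edges are sets of endpoints, so the coupling defined by a perfect matching M
   is M itself. *)
definition perfect_matching :: "'a pair_pre_digraph \<Rightarrow> 'a set set \<Rightarrow> bool" where
  "perfect_matching G M \<longleftrightarrow> M \<subseteq> edges G \<and> (\<forall>v \<in> pverts G. \<exists>!e. e \<in> M \<and> v \<in> e)"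

definition coupled_nbhd :: "'a pair_pre_digraph \<Rightarrow> 'a set set \<Rightarrow> 'a \<Rightarrow> 'a set" where
  "coupled_nbhd G C v = nbhd G v \<union> {partner C v}"

inductive coupled_step :: "'a pair_pre_digraph \<Rightarrow> 'a set set \<Rightarrow> 'a set \<Rightarrow> 'a set \<Rightarrow> bool"
  for G :: "'a pair_pre_digraph" and C :: "'a set set" where
  force: "v \<in> B \<Longrightarrow> coupled_nbhd G C v - B = {w} \<Longrightarrow> coupled_step G C B (insert w B)"
| self: "v \<in> pverts G - B \<Longrightarrow> coupled_nbhd G C v \<subseteq> B \<Longrightarrow> coupled_step G C B (insert v B)"

definition coupled_zero_forcing_set :: "'a pair_pre_digraph \<Rightarrow> 'a set set \<Rightarrow> 'a set \<Rightarrow> bool" where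
  "coupled_zero_forcing_set G C B \<longleftrightarrow> B \<subseteq> pverts G \<and> (coupled_step G C)\<^sup>*\<^sup>* B (pverts G)"

definition coupled_zero_forcing_number :: "'a pair_pre_digraph \<Rightarrow> 'a set set \<Rightarrow> nat" where
  "coupled_zero_forcing_number G C = (LEAST k. \<exists>B. coupled_zero_forcing_set G C B \<and> card B = k)"

end

theory Submission
  imports Defs
begin

text \<open>
  Why the theorem holds. Let a single blue vertex be given. At every moment at most one blue
  vertex still has white neighbours, namely the end of a growing path (the spine). A force by a
  vertex extends the spine by one vertex; a self-force attaches a leaf to the end of the spine. Either
  way the new vertex has exactly one blue neighbour, so the blue part stays a tree and is
  dominated by its spine: what gets coloured is a caterpillar
  (\<open>loop_steps_imp_caterpillar\<close>). Conversely, in a caterpillar with spine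
  \<open>P\<close>, colour the first vertex of \<open>P\<close>. Acyclicity says that the vertices off \<open>P\<close> are
  leaves and that \<open>P\<close> has no chords. So whenever a spine vertex turns blue, its leaves force
  themselves, and then the next spine vertex is its only white neighbour
  (\<open>caterpillar_imp_loop_steps\<close>). The empty set forces nothing, hence the forcing number is
  1 exactly for caterpillars.

  The coupled neighbourhood of a vertex is its neighbourhood in \<open>G(C)\<close>, which has no isolated
  vertices. Therefore coupled forcing on \<open>G\<close> is loop forcing on \<open>G(C)\<close>, and the second claim
  is the first one for \<open>G(C)\<close>, the coupling itself being a perfect matching of \<open>G(C)\<close>. If \<open>G\<close> is
  connected and \<open>G(C)\<close> is a tree, then the spanning subgraph \<open>G\<close> cannot miss an edge, because a path
  in \<open>G\<close> joining the ends of that edge would close a cycle. So \<open>G(C) = G\<close>, which says that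
  \<open>C\<close> consists of edges of \<open>G\<close>.
\<close>

section \<open>Cycles and paths\<close>

definition has_cycle :: "'a pair_pre_digraph \<Rightarrow> bool" where
  "has_cycle G \<longleftrightarrow> (\<exists>p. pre_digraph.cycle (with_proj G) p \<and> length p \<ge> 3)"

lemma undirected_tree_iff:
  "undirected_tree G \<longleftrightarrow> Digraph_Component.connected (with_proj G) \<and> \<not> has_cycle G"
  by (simp add: undirected_tree_def has_cycle_def)

lemma pcas_vwalk_arcs: "pcas u (vwalk_arcs (u # xs)) (last (u # xs))"
  by (induction xs arbitrary: u) auto

lemma pawalk_verts_vwalk_arcs: "pawalk_verts u (vwalk_arcs (u # xs)) = u # xs"
  by (induction xs arbitrary: u) auto

text \<open>
  A set in which every vertex has two neighbours of the set. Cycles give such sets, and their absence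
  survives the addition of a vertex with at most one neighbour, which makes acyclicity an
  invariant of colouring without any manipulation of walks.
\<close>
definition min_degree_two :: "'a pair_pre_digraph \<Rightarrow> 'a set \<Rightarrow> bool" where
  "min_degree_two G S \<longleftrightarrow>
     (\<forall>x\<in>S. \<exists>y\<in>S. \<exists>z\<in>S. y \<noteq> z \<and> (x, y) \<in> parcs G \<and> (x, z) \<in> parcs G)"

lemma min_degree_two_insert:
  assumes "min_degree_two G S" and "S \<subseteq> insert w B"
    and "\<And>y. (w, y) \<in> parcs G \<Longrightarrow> y \<in> insert w B \<Longrightarrow> y = l"
  shows "S \<subseteq> B"
  using assms unfolding min_degree_two_def by (metis insertE subset_iff)

context pair_graph
begin

lemma connected_iff:
  "Digraph_Component.connected (with_proj G) \<longleftrightarrow>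
     pverts G \<noteq> {} \<and> (\<forall>u\<in>pverts G. \<forall>v\<in>pverts G. reachable (with_proj G) u v)"
proof -
  have "(parcs G)\<^sup>s = parcs G"
    using arcs_symmetric by (auto simp: symcl_def)
  then show ?thesis
    by (simp add: connected_conv reachable_def)
qed

lemma closed_vpath_imp_has_cycle:
  assumes P: "vpath P (with_proj G)" and len: "length P \<ge> 3" and arc: "(last P, hd P) \<in> parcs G"
  shows "has_cycle G"
proof -
  obtain u xs where Pu: "P = u # xs" using len by (cases P) auto
  have xs: "xs \<noteq> []" using len Pu by auto
  let ?p = "vwalk_arcs (P @ [u])"
  have arcs: "set ?p \<subseteq> parcs G"
    using P arc set_vwalk_arcs_snoc[of P u] Pu by (auto simp: vpath_def vwalk_def)
  have "awalk u ?p u"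
    unfolding awalk_def using P Pu arcs pcas_vwalk_arcs[of u "xs @ [u]"]
    by (auto simp: vpath_def vwalk_def)
  moreover have "distinct (tl (awalk_verts u ?p))"
    using P Pu pawalk_verts_vwalk_arcs[of u "xs @ [u]"] by (auto simp: vpath_def)
  moreover have lp: "length ?p \<ge> 3"
    using len vwalk_length_simp[of "P @ [u]", unfolded vwalk_length_def] by simp
  ultimately have "cycle ?p"
    unfolding cycle_def by (metis list.size(3) not_numeral_le_zero)
  then show ?thesis using lp unfolding has_cycle_def by blast
qed

lemma pcas_nth_arc:
  "pcas u p v \<Longrightarrow> i < length p \<Longrightarrow> p ! i = (pawalk_verts u p ! i, pawalk_verts u p ! Suc i)"
proof (induction p arbitrary: u i)
  case (Cons e p)
  then show ?case by (cases i; cases p) (auto simp: prod_eq_iff)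
qed simp

lemma pcas_ends:
  "pcas u p v \<Longrightarrow> pawalk_verts u p ! 0 = u \<and> pawalk_verts u p ! length p = v"
  by (induction p arbitrary: u) auto

lemma cycle_imp_min_degree_two:
  assumes "has_cycle G"
  obtains S where "S \<noteq> {}" "S \<subseteq> pverts G" "min_degree_two G S"
proof -
  obtain p u where aw: "awalk u p u" and d: "distinct (tl (awalk_verts u p))" and len: "length p \<ge> 3"
    using assms unfolding has_cycle_def cycle_def by blast
  define n where "n = length p"
  have npos: "0 < n" using len by (auto simp: n_def)
  define f where "f i = pawalk_verts u p ! i" for i
  have cas: "pcas u p u" and parcs: "set p \<subseteq> parcs G" using aw by (auto simp: awalk_def)
  have lenv: "length (pawalk_verts u p) = Suc n"
    using length_awalk_verts[of u p] by (simp add: n_def)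
  have arc: "(f i, f (Suc i)) \<in> parcs G" if "i < n" for i
    using pcas_nth_arc[OF cas, of i] that parcs nth_mem[of i p] by (auto simp: n_def f_def)
  have f0: "f 0 = f n" using pcas_ends[OF cas] by (simp add: n_def f_def)
  have inj: "i = j" if "f i = f j" "1 \<le> i" "i \<le> n" "1 \<le> j" "j \<le> n" for i j
  proof -
    have "tl (pawalk_verts u p) ! (i - 1) = tl (pawalk_verts u p) ! (j - 1)"
      using that lenv by (simp add: nth_tl f_def)
    then have "i - 1 = j - 1"
      using that lenv nth_eq_iff_index_eq[OF d, of "i - 1" "j - 1"] by auto
    then show ?thesis using that by linarith
  qed
  define S where "S = f ` {1..n}"
  have fS: "f i \<in> S" if "i \<le> n" for i
    using that f0 len by (cases "i = 0") (auto simp: S_def n_def)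
  have "\<exists>y\<in>S. \<exists>z\<in>S. y \<noteq> z \<and> (x, y) \<in> parcs G \<and> (x, z) \<in> parcs G" if "x \<in> S" for x
  proof -
    obtain i where i: "1 \<le> i" "i \<le> n" "x = f i" using \<open>x \<in> S\<close> by (auto simp: S_def)
    \<comment> \<open>The walk lists its base point twice, at positions 0 and \<open>n\<close>; indices are read cyclically
        in \<open>1, ..., n\<close>.\<close>
    define a where "a = (if i = 1 then n else i - 1)"
    define b where "b = (if i = n then 1 else Suc i)"
    have ab: "1 \<le> a" "a \<le> n" "1 \<le> b" "b \<le> n" "a \<noteq> b"
      using i len by (auto simp: a_def b_def n_def)
    have "(f a, x) \<in> parcs G"
      using arc[of "i - 1"] i f0 by (auto simp: a_def split: if_splits)
    then have "(x, f a) \<in> parcs G" by (rule arcs_symmetric)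
    moreover have "(x, f b) \<in> parcs G"
      using arc[of i] arc[OF npos] i f0 by (auto simp: b_def)
    moreover have "f a \<noteq> f b" using inj ab by blast
    ultimately show ?thesis using fS ab by blast
  qed
  then have m: "min_degree_two G S" unfolding min_degree_two_def by blast
  have "S \<subseteq> pverts G"
  proof
    fix x assume "x \<in> S"
    then obtain y where "(x, y) \<in> parcs G" using m unfolding min_degree_two_def by blast
    then show "x \<in> pverts G" by (rule in_arcsD1)
  qed
  moreover have "S \<noteq> {}" using len by (auto simp: S_def n_def)
  ultimately show ?thesis using that m by blast
qed

lemma vpath_Cons:
  assumes "vpath Q (with_proj G)" "(x, hd Q) \<in> parcs G" "x \<notin> set Q"
  shows "vpath (x # Q) (with_proj G)"
  using assms in_arcsD1 by (auto simp: vpath_def intro!: vwalk_consI)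

lemma vpath_snoc:
  assumes "vpath Q (with_proj G)" "(last Q, x) \<in> parcs G" "x \<notin> set Q"
  shows "vpath (Q @ [x]) (with_proj G)"
  using assms in_arcsD2 set_vwalk_arcs_snoc[of Q x] by (auto simp: vpath_def vwalk_def)

lemma vpath_append2:
  assumes "vpath (P @ Q) (with_proj G)" "Q \<noteq> []"
  shows "vpath Q (with_proj G)"
  using assms by (auto simp: vpath_def intro: vwalkI_append_r)

lemma vpath_append1:
  assumes "vpath (P @ Q) (with_proj G)" "P \<noteq> []"
  shows "vpath P (with_proj G)"
  using assms by (auto simp: vpath_def intro: vwalkI_append_l)

lemma vpath_rev:
  assumes "vpath P (with_proj G)"
  shows "vpath (rev P) (with_proj G)"
  using assms pair_sym_arcs by (auto simp: vpath_def intro: vwalk_rev_ex)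

lemma vpath_segment_ordered:
  assumes "vpath P (with_proj G)" "P = xs @ b # ys" "c \<in> set (b # ys)"
  obtains Q where "vpath Q (with_proj G)" "hd Q = b" "last Q = c" "set Q \<subseteq> set P"
proof -
  obtain us vs where split: "b # ys = us @ c # vs" using assms(3) by (meson split_list)
  have P: "P = xs @ (us @ [c]) @ vs" using assms(2) split by simp
  have "vpath ((us @ [c]) @ vs) (with_proj G)"
    using vpath_append2[of xs "(us @ [c]) @ vs"] assms(1) P by simp
  then have "vpath (us @ [c]) (with_proj G)"
    using vpath_append1[of "us @ [c]" vs] by simp
  moreover have "hd (us @ [c]) = b" using split by (cases us) auto
  ultimately show ?thesis using that[of "us @ [c]"] P by auto
qed

lemma vpath_segment:
  assumes P: "vpath P (with_proj G)" and b: "b \<in> set P" and c: "c \<in> set P"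
  obtains Q where "vpath Q (with_proj G)" "hd Q = b" "last Q = c" "set Q \<subseteq> set P"
proof -
  obtain xs ys where split: "P = xs @ b # ys" using b by (meson split_list)
  show ?thesis
  proof (cases "c \<in> set (b # ys)")
    case True
    then show ?thesis using vpath_segment_ordered[OF P split] that by blast
  next
    case False
    then have "c \<in> set (b # rev xs)" using c split by auto
    moreover have "rev P = rev ys @ b # rev xs" using split by simp
    ultimately show ?thesis
      using vpath_segment_ordered[OF vpath_rev[OF P]] that by (metis set_rev)
  qed
qed

section \<open>Paths in acyclic graphs\<close>

lemma acyclic_path_chordless:
  assumes ac: "\<not> has_cycle G" and P: "vpath (xs @ b # ys) (with_proj G)"
    and c: "c \<in> set ys" and arc: "(b, c) \<in> parcs G"
  shows "c = hd ys"
proof -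
  obtain us vs where ys: "ys = us @ c # vs" using c by (meson split_list)
  have "vpath ((b # us @ [c]) @ vs) (with_proj G)"
    using vpath_append2[OF P] ys by simp
  then have "vpath (b # us @ [c]) (with_proj G)"
    using vpath_append1[of "b # us @ [c]" vs] by simp
  then have "\<not> length (b # us @ [c]) \<ge> 3"
    using ac closed_vpath_imp_has_cycle[of "b # us @ [c]"] arcs_symmetric[OF arc] by auto
  then have "us = []" by (cases us) auto
  then show ?thesis using ys by simp
qed

lemma acyclic_one_neighbour_on_path:
  assumes ac: "\<not> has_cycle G" and P: "vpath P (with_proj G)" and x: "x \<notin> set P"
    and b: "b \<in> set P" "(x, b) \<in> parcs G" and c: "c \<in> set P" "(x, c) \<in> parcs G"
  shows "b = c"
proof (rule ccontr)
  assume "b \<noteq> c"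
  obtain Q where Q: "vpath Q (with_proj G)" "hd Q = b" "last Q = c" "set Q \<subseteq> set P"
    using vpath_segment[OF P b(1) c(1)] .
  have ne: "Q \<noteq> []" using Q(1) by (auto simp: vpath_def)
  have len: "length Q \<ge> 2" using \<open>b \<noteq> c\<close> Q(2,3) ne by (cases Q; cases "tl Q") auto
  have "vpath (x # Q) (with_proj G)" using vpath_Cons Q b x by blast
  then show False
    using ac closed_vpath_imp_has_cycle[of "x # Q"] len Q(3) ne arcs_symmetric[OF c(2)] by auto
qed

lemma acyclic_neighbours_of_path_nonadjacent:
  assumes ac: "\<not> has_cycle G" and P: "vpath P (with_proj G)" and xy: "x \<notin> set P" "y \<notin> set P"
    and b: "b \<in> set P" "(x, b) \<in> parcs G" and c: "c \<in> set P" "(y, c) \<in> parcs G"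
  shows "(x, y) \<notin> parcs G"
proof
  assume arc: "(x, y) \<in> parcs G"
  obtain Q where Q: "vpath Q (with_proj G)" "hd Q = b" "last Q = c" "set Q \<subseteq> set P"
    using vpath_segment[OF P b(1) c(1)] .
  have ne: "Q \<noteq> []" using Q(1) by (auto simp: vpath_def)
  have "x \<noteq> y" using arc no_loops' by blast
  have Qy: "vpath (Q @ [y]) (with_proj G)" using vpath_snoc Q xy arcs_symmetric[OF c(2)] by blast
  have "vpath (x # Q @ [y]) (with_proj G)"
    by (rule vpath_Cons[OF Qy]) (use ne Q xy b \<open>x \<noteq> y\<close> in auto)
  then show False
    using ac closed_vpath_imp_has_cycle[of "x # Q @ [y]"] ne arcs_symmetric[OF arc]
    by (cases Q) auto
qed

section \<open>A single vertex forces only caterpillars\<close>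

text \<open>
  The shape of the blue set \<open>B\<close> with spine \<open>P\<close>. White neighbours occur only at the end of the
  spine, so that the next vertex to turn blue hangs on that end.
\<close>
definition blue_caterpillar :: "'a \<Rightarrow> 'a set \<Rightarrow> 'a list \<Rightarrow> bool" where
  "blue_caterpillar v B P \<longleftrightarrow>
     B \<subseteq> pverts G \<and> vpath P (with_proj G) \<and> set P \<subseteq> B \<and>
     (\<forall>x\<in>B - set P. \<exists>w\<in>set P. (x, w) \<in> parcs G) \<and>
     (\<forall>x\<in>B. nbhd G x \<subseteq> B \<or> x = last P) \<and>
     (\<forall>S. S \<subseteq> B \<longrightarrow> min_degree_two G S \<longrightarrow> S = {}) \<and>
     (\<forall>x\<in>B. reachable (with_proj G) v x)"

lemma blue_caterpillar_singleton:
  assumes "v \<in> pverts G"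
  shows "blue_caterpillar v {v} [v]"
  using assms no_loops' unfolding blue_caterpillar_def min_degree_two_def
  by (auto simp: vpath_self) blast

text \<open>
  A white vertex adjacent to the blue set can only be adjacent to the end of the spine; its blue
  degree is therefore at most one, and no cycle is closed.
\<close>
lemma blue_caterpillar_insert:
  assumes inv: "blue_caterpillar v B P" and w: "w \<notin> B" and arc: "(last P, w) \<in> parcs G"
  shows "(\<And>S. S \<subseteq> insert w B \<Longrightarrow> min_degree_two G S \<Longrightarrow> S = {})"
    and "reachable (with_proj G) v w"
proof -
  have only: "y = last P" if "(w, y) \<in> parcs G" "y \<in> insert w B" for y
  proof -
    have "y \<in> B" using that no_loops' by blast
    moreover have "w \<in> nbhd G y" using that arcs_symmetric by (auto simp: nbhd_def)
    ultimately show ?thesis using inv w by (auto simp: blue_caterpillar_def)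
  qed
  show "S = {}" if "S \<subseteq> insert w B" "min_degree_two G S" for S
    using min_degree_two_insert[OF that(2,1) only] inv that(2) by (auto simp: blue_caterpillar_def)
  have "last P \<in> B" using inv by (auto simp: blue_caterpillar_def vpath_def vwalk_def)
  then have "reachable (with_proj G) v (last P)" using inv by (auto simp: blue_caterpillar_def)
  then show "reachable (with_proj G) v w" using arc reachable_adj_trans by auto
qed

lemma blue_caterpillar_step:
  assumes step: "loop_step G B B'" and inv: "blue_caterpillar v B P"
  shows "\<exists>P'. blue_caterpillar v B' P'"
  using step
proof cases
  case (force u w)
  have "\<not> nbhd G u \<subseteq> B" using force(3) by blast
  then have u: "u = last P" using force(2) inv by (auto simp: blue_caterpillar_def)
  have arc: "(last P, w) \<in> parcs G" and w: "w \<notin> B"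
    using force u by (auto simp: nbhd_def)
  note ins = blue_caterpillar_insert[OF inv w arc]
  have "vpath (P @ [w]) (with_proj G)"
    using vpath_snoc[OF _ arc] inv w by (auto simp: blue_caterpillar_def)
  moreover have "nbhd G x \<subseteq> insert w B" if "x \<in> B" for x
    using that force(3) inv u unfolding blue_caterpillar_def by blast
  ultimately have "blue_caterpillar v (insert w B) (P @ [w])"
    using inv ins in_arcsD2[OF arc] unfolding blue_caterpillar_def by auto
  then show ?thesis using force(1) by blast
next
  case (self w)
  have nb: "y = last P" if "y \<in> nbhd G w" for y
  proof -
    have "y \<in> B" "w \<in> nbhd G y" using that self arcs_symmetric by (auto simp: nbhd_def)
    then show ?thesis using self inv by (auto simp: blue_caterpillar_def)
  qed
  then have wl: "(w, last P) \<in> parcs G" using self by (auto simp: nbhd_def)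
  have w: "w \<notin> B" using self by simp
  have Pne: "P \<noteq> []" using inv by (auto simp: blue_caterpillar_def vpath_def)
  note ins = blue_caterpillar_insert[OF inv w arcs_symmetric[OF wl]]
  have "\<exists>z\<in>set P. (x, z) \<in> parcs G" if "x \<in> insert w B - set P" for x
  proof (cases "x = w")
    case True
    then show ?thesis using wl Pne last_in_set by blast
  next
    case False
    then show ?thesis using that inv unfolding blue_caterpillar_def by blast
  qed
  moreover have "nbhd G x \<subseteq> insert w B \<or> x = last P" if "x \<in> insert w B" for x
    using that self(4) inv unfolding blue_caterpillar_def by blast
  ultimately have "blue_caterpillar v (insert w B) P"
    using inv ins self unfolding blue_caterpillar_def by auto
  then show ?thesis using self(1) by blast
qed

lemma loop_steps_imp_caterpillar:
  assumes v: "v \<in> pverts G" and steps: "(loop_step G)\<^sup>*\<^sup>* {v} (pverts G)"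
  shows "caterpillar G"
proof -
  have "\<exists>P. blue_caterpillar v B P" if "(loop_step G)\<^sup>*\<^sup>* {v} B" for B
    using that by (induction) (use blue_caterpillar_singleton[OF v] blue_caterpillar_step in blast)+
  then obtain P where P: "blue_caterpillar v (pverts G) P" using steps by blast
  have "\<not> has_cycle G"
    using cycle_imp_min_degree_two P unfolding blue_caterpillar_def by metis
  moreover have "Digraph_Component.connected (with_proj G)"
    unfolding connected_iff
  proof (intro conjI ballI)
    show "pverts G \<noteq> {}" using v by blast
  next
    fix a b assume "a \<in> pverts G" "b \<in> pverts G"
    then have "reachable (with_proj G) v a" "reachable (with_proj G) v b"
      using P by (auto simp: blue_caterpillar_def)
    then show "reachable (with_proj G) a b"
      using symmetric_reachable' reachable_trans by blast
  qed
  moreover have "vpath P (with_proj G)"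
    and "\<forall>x\<in>pverts G - set P. \<exists>w\<in>set P. (x, w) \<in> parcs G"
    using P by (simp_all add: blue_caterpillar_def)
  ultimately show ?thesis
    unfolding caterpillar_def undirected_tree_iff by (intro conjI exI[of _ P])
qed

section \<open>The first spine vertex forces a caterpillar\<close>

lemma loop_steps_self:
  assumes "finite W"
    and "\<And>w. w \<in> W \<Longrightarrow> w \<in> pverts G \<and> nbhd G w \<noteq> {} \<and> nbhd G w \<subseteq> B"
  shows "(loop_step G)\<^sup>*\<^sup>* B (B \<union> W)"
  using assms
proof (induction W)
  case (insert w W)
  have IH: "(loop_step G)\<^sup>*\<^sup>* B (B \<union> W)" using insert by blast
  show ?case
  proof (cases "w \<in> B \<union> W")
    case True
    then show ?thesis using IH by (simp add: insert_absorb)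
  next
    case False
    then have "loop_step G (B \<union> W) (insert w (B \<union> W))"
      using insert.prems[of w] by (intro loop_step.self) auto
    then show ?thesis using IH by (simp add: rtranclp.rtrancl_into_rtrancl)
  qed
qed simp

definition leaves_of :: "'a list \<Rightarrow> 'a list \<Rightarrow> 'a set" where
  "leaves_of P xs = {x \<in> pverts G - set P. \<exists>w\<in>set xs. (x, w) \<in> parcs G}"

text \<open>
  Here \<open>xs\<close> is the part of the spine that is already blue together with its leaves, and \<open>b\<close> has just
  turned blue. A leaf of \<open>b\<close> has no neighbour besides \<open>b\<close>, since a second one would close a
  cycle through the spine; so it forces itself. As the spine has no chords, the successor of \<open>b\<close> is
  then the only white neighbour of \<open>b\<close>.
\<close>
lemma loop_steps_along_spine:
  assumes ac: "\<not> has_cycle G" and P: "vpath P (with_proj G)"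
    and dom: "\<forall>v\<in>pverts G - set P. \<exists>w\<in>set P. (v, w) \<in> parcs G"
    and split: "P = xs @ b # ys"
  shows "(loop_step G)\<^sup>*\<^sup>* (insert b (set xs \<union> leaves_of P xs)) (set P \<union> leaves_of P P)"
  using split
proof (induction ys arbitrary: xs b)
  have leaves: "(loop_step G)\<^sup>*\<^sup>* (insert b (set xs \<union> leaves_of P xs))
                  (set (xs @ [b]) \<union> leaves_of P (xs @ [b]))"
    if split: "P = xs @ b # ys" for xs b ys
  proof -
    let ?W = "{x \<in> pverts G - set P. (x, b) \<in> parcs G}"
    have "nbhd G x \<subseteq> {b}" if x: "x \<in> ?W" for x
    proof
      fix y assume "y \<in> nbhd G x"
      then have xy: "(x, y) \<in> parcs G" by (simp add: nbhd_def)
      have b: "b \<in> set P" "(x, b) \<in> parcs G" and xP: "x \<notin> set P" using split x by auto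
      show "y \<in> {b}"
      proof (cases "y \<in> set P")
        case True
        then show ?thesis using acyclic_one_neighbour_on_path[OF ac P xP b _ xy] by simp
      next
        case False
        then obtain c where "c \<in> set P" "(y, c) \<in> parcs G" using dom in_arcsD2[OF xy] by blast
        then show ?thesis
          using acyclic_neighbours_of_path_nonadjacent[OF ac P xP False b] xy by blast
      qed
    qed
    then have "(loop_step G)\<^sup>*\<^sup>* (insert b (set xs \<union> leaves_of P xs))
                 (insert b (set xs \<union> leaves_of P xs) \<union> ?W)"
      by (intro loop_steps_self) (auto simp: nbhd_def pair_finite_verts)
    moreover have "insert b (set xs \<union> leaves_of P xs) \<union> ?W
                     = set (xs @ [b]) \<union> leaves_of P (xs @ [b])"
      by (auto simp: leaves_of_def)
    ultimately show ?thesis by simp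
  qed
  {
    case (Nil xs b)
    then show ?case using leaves[of xs b "[]"] by simp
  next
    case (Cons c ys xs b)
    let ?B = "set (xs @ [b]) \<union> leaves_of P (xs @ [b])"
    have "distinct P" using P by (auto simp: vpath_def)
    have "(b, c) \<in> parcs G"
      using P Cons.prems in_set_vwalk_arcs_append2[of "xs @ [b]" "c # ys" "(b, c)"]
      by (auto simp: vpath_def vwalk_def)
    moreover have "y \<in> insert c ?B" if y: "(b, y) \<in> parcs G" for y
    proof (cases "y \<in> set P")
      case False
      then show ?thesis
        using in_arcsD2[OF y] arcs_symmetric[OF y] by (auto simp: leaves_of_def)
    next
      case True
      then consider "y \<in> set (xs @ [b])" | "y \<in> set (c # ys)" using Cons.prems by auto
      then show ?thesis
      proof cases
        case 2
        then show ?thesis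
          using acyclic_path_chordless[OF ac, of xs b "c # ys" y] P Cons.prems y by auto
      qed auto
    qed
    moreover have "c \<notin> ?B"
      using Cons.prems \<open>distinct P\<close> by (auto simp: leaves_of_def)
    ultimately have "nbhd G b - ?B = {c}" by (auto simp: nbhd_def)
    then have "loop_step G ?B (insert c ?B)" by (intro loop_step.force[of b]) auto
    moreover have "(loop_step G)\<^sup>*\<^sup>* (insert c ?B) (set P \<union> leaves_of P P)"
      using Cons.IH[of "xs @ [b]" c] Cons.prems by simp
    ultimately show ?case
      using leaves[OF Cons.prems] by (meson converse_rtranclp_into_rtranclp rtranclp_trans)
  }
qed

lemma caterpillar_imp_loop_steps:
  assumes "caterpillar G"
  shows "\<exists>v\<in>pverts G. (loop_step G)\<^sup>*\<^sup>* {v} (pverts G)"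
proof -
  obtain P where ac: "\<not> has_cycle G" and P: "vpath P (with_proj G)"
    and dom: "\<forall>v\<in>pverts G - set P. \<exists>w\<in>set P. (v, w) \<in> parcs G"
    using assms unfolding caterpillar_def undirected_tree_iff by blast
  have sub: "set P \<subseteq> pverts G" using P by (auto simp: vpath_def vwalk_def)
  obtain b ys where split: "P = [] @ b # ys" using P by (cases P) (auto simp: vpath_def)
  have "leaves_of P [] = {}" by (simp add: leaves_of_def)
  moreover have "set P \<union> leaves_of P P = pverts G"
    using sub dom by (auto simp: leaves_of_def)
  ultimately have "(loop_step G)\<^sup>*\<^sup>* {b} (pverts G)"
    using loop_steps_along_spine[OF ac P dom split] by simp
  moreover have "b \<in> pverts G" using sub split by auto
  ultimately show ?thesis by blast
qed

text \<open>
  Nothing is forced from the empty set: a self-force requires a neighbour, and that neighbour must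
  be blue. So the forcing number of a nonempty graph is positive.
\<close>
lemma loop_steps_empty:
  assumes "(loop_step G)\<^sup>*\<^sup>* {} B"
  shows "B = {}"
  using assms by induction (auto elim: loop_step.cases)

lemma loop_zero_forcing_number_eq_1_iff:
  assumes "pverts G \<noteq> {}"
  shows "loop_zero_forcing_number G = 1 \<longleftrightarrow> caterpillar G"
proof -
  let ?ex = "\<lambda>k. \<exists>B. loop_zero_forcing_set G B \<and> card B = k"
  have "?ex (card (pverts G))" by (auto simp: loop_zero_forcing_set_def)
  then have least: "?ex (loop_zero_forcing_number G)"
    unfolding loop_zero_forcing_number_def by (rule LeastI)
  have no0: "\<not> ?ex 0"
  proof
    assume "?ex 0"
    then obtain B where "loop_zero_forcing_set G B" "card B = 0" by blast
    moreover from this have "B = {}"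
      using finite_subset[OF _ pair_finite_verts] by (auto simp: loop_zero_forcing_set_def)
    ultimately show False using loop_steps_empty assms by (auto simp: loop_zero_forcing_set_def)
  qed
  have "loop_zero_forcing_number G = 1 \<longleftrightarrow> ?ex 1"
  proof
    assume ex: "?ex 1"
    then have "loop_zero_forcing_number G \<le> 1"
      unfolding loop_zero_forcing_number_def by (rule Least_le)
    moreover have "loop_zero_forcing_number G \<noteq> 0" using least no0 by metis
    ultimately show "loop_zero_forcing_number G = 1" by simp
  qed (use least in simp)
  also have "\<dots> \<longleftrightarrow> (\<exists>v\<in>pverts G. (loop_step G)\<^sup>*\<^sup>* {v} (pverts G))"
    by (auto simp: loop_zero_forcing_set_def card_1_singleton_iff)
  also have "\<dots> \<longleftrightarrow> caterpillar G"
    using loop_steps_imp_caterpillar caterpillar_imp_loop_steps by blast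
  finally show ?thesis .
qed

end

section \<open>Coupled forcing is loop forcing on the completed graph\<close>

text \<open>
  An edge of the acyclic graph outside a connected spanning subgraph would close a cycle with the
  path that joins its ends in the subgraph.
\<close>
lemma connected_spanning_subgraph_of_acyclic:
  assumes G: "pair_graph G" and H: "pair_graph H"
    and verts: "pverts H = pverts G" and arcs: "parcs G \<subseteq> parcs H"
    and conn: "Digraph_Component.connected (with_proj G)" and ac: "\<not> has_cycle H"
  shows "H = G"
proof -
  interpret G: pair_graph G by (rule G)
  interpret H: pair_graph H by (rule H)
  have "(a, b) \<in> parcs G" if ab: "(a, b) \<in> parcs H" for a b
  proof (rule ccontr)
    assume nG: "(a, b) \<notin> parcs G"
    have "reachable (with_proj G) a b"
      using conn ab verts H.in_arcsD1 H.in_arcsD2 by (auto simp: G.connected_iff)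
    then obtain Q where Q: "vpath Q (with_proj G)" "hd Q = a" "last Q = b"
      using G.reachable_vpath_conv by blast
    have "vpath Q (with_proj H)" using Q(1) arcs verts by (auto simp: vpath_def vwalk_def)
    moreover have "(last Q, hd Q) \<in> parcs H" using Q H.arcs_symmetric[OF ab] by simp
    moreover have "length Q \<ge> 3"
    proof (rule ccontr)
      assume "\<not> length Q \<ge> 3"
      then consider "Q = []" | x where "Q = [x]" | x y where "Q = [x, y]"
        by (cases Q; cases "tl Q"; cases "tl (tl Q)") auto
      then show False
        using Q nG H.no_loops'[OF ab] by cases (auto simp: vpath_def vwalk_def)
    qed
    ultimately show False using H.closed_vpath_imp_has_cycle ac by blast
  qed
  then have "parcs H = parcs G" using arcs by auto
  then show ?thesis using verts by simp
qed

lemma coupling_partner: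
  assumes C: "is_coupling G C" and v: "v \<in> pverts G"
  shows "{v, partner C v} \<in> C" and "partner C v \<in> pverts G" and "partner C v \<noteq> v"
    and "e \<in> C \<Longrightarrow> v \<in> e \<Longrightarrow> e = {v, partner C v}"
proof -
  have part: "partition_on (pverts G) C" and two: "\<And>e. e \<in> C \<Longrightarrow> card e = 2"
    using C by (auto simp: is_coupling_def)
  have uniq: "e = e'" if "e \<in> C" "e' \<in> C" "v \<in> e" "v \<in> e'" for e e'
    using part that by (auto simp: partition_on_def disjoint_def)
  obtain d where d: "d \<in> C" "v \<in> d" using part v by (auto simp: partition_on_def)
  obtain w where w: "d = {v, w}" "w \<noteq> v"
    using two[OF d(1)] d(2) by (auto simp: card_2_iff doubleton_eq_iff)
  have "partner C v = w"
    unfolding partner_def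
  proof (rule the_equality)
    show "w' = w" if "{v, w'} \<in> C" for w'
      using uniq[OF that d(1)] w by (auto simp: doubleton_eq_iff)
  qed (use d w in simp)
  then show "{v, partner C v} \<in> C" "partner C v \<noteq> v" using d w by auto
  then show "partner C v \<in> pverts G" using part by (auto simp: partition_on_def)
  show "e \<in> C \<Longrightarrow> v \<in> e \<Longrightarrow> e = {v, partner C v}"
    using uniq \<open>{v, partner C v} \<in> C\<close> by blast
qed

lemma coupling_partner_partner:
  assumes C: "is_coupling G C" and v: "v \<in> pverts G"
  shows "partner C (partner C v) = v"
  using coupling_partner(4)[OF C coupling_partner(2)[OF C v] coupling_partner(1)[OF C v]]
    coupling_partner(3)[OF C v] by (auto simp: doubleton_eq_iff)

lemma coupling_elem:
  assumes C: "is_coupling G C" and e: "e \<in> C"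
  obtains v where "v \<in> pverts G" "e = {v, partner C v}"
proof -
  have "e \<subseteq> pverts G" "e \<noteq> {}"
    using C e by (auto simp: is_coupling_def partition_on_def)
  then obtain v where "v \<in> pverts G" "v \<in> e" by blast
  then show ?thesis using that coupling_partner(4)[OF C _ e] by blast
qed

lemma pair_graph_add_coupling:
  assumes G: "pair_graph G" and C: "is_coupling G C"
  shows "pair_graph (add_coupling G C)"
proof -
  interpret G: pair_graph G by (rule G)
  let ?H = "add_coupling G C"
  have sub: "parcs ?H \<subseteq> pverts G \<times> pverts G"
    using coupling_partner(2)[OF C] G.in_arcsD1 G.in_arcsD2 by (auto simp: add_coupling_def)
  then have "finite (parcs ?H)" using G.pair_finite_verts by (meson finite_SigmaI finite_subset)
  moreover have "sym (parcs ?H)"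
    using G.arcs_symmetric by (auto simp: add_coupling_def sym_def)
  moreover have "fst e \<noteq> snd e" if "e \<in> parcs ?H" for e
    using that G.pair_no_loops[of e] coupling_partner(3)[OF C] by (fastforce simp: add_coupling_def)
  ultimately show ?thesis
    using sub G.pair_finite_verts
    by unfold_locales (auto simp: symmetric_def add_coupling_def)
qed

lemma nbhd_add_coupling:
  assumes C: "is_coupling G C" and v: "v \<in> pverts G"
  shows "nbhd (add_coupling G C) v = coupled_nbhd G C v"
  using v coupling_partner_partner[OF C]
  by (auto simp: nbhd_def coupled_nbhd_def add_coupling_def)

text \<open>
  Loop forcing lets only non-isolated vertices force themselves. In the completed graph every vertex
  is adjacent to its partner, so this restriction is always met.
\<close>
lemma coupled_step_iff_loop_step:
  assumes C: "is_coupling G C" and B: "B \<subseteq> pverts G"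
  shows "coupled_step G C B B' \<longleftrightarrow> loop_step (add_coupling G C) B B'"
proof
  assume "coupled_step G C B B'"
  then show "loop_step (add_coupling G C) B B'"
  proof cases
    case (force v w)
    then show ?thesis using B nbhd_add_coupling[OF C] by (auto intro!: loop_step.force[of v])
  next
    case (self v)
    then have "nbhd (add_coupling G C) v = coupled_nbhd G C v"
      using nbhd_add_coupling[OF C] by simp
    then show ?thesis
      using self by (auto intro!: loop_step.self simp: add_coupling_def coupled_nbhd_def)
  qed
next
  assume "loop_step (add_coupling G C) B B'"
  then show "coupled_step G C B B'"
  proof cases
    case (force v w)
    then show ?thesis
      using B nbhd_add_coupling[OF C, of v] by (auto intro!: coupled_step.force[of v])
  next
    case (self v)
    then have v: "v \<in> pverts G - B" by (simp add: add_coupling_def)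
    then show ?thesis
      using self nbhd_add_coupling[OF C, of v] by (auto intro!: coupled_step.self)
  qed
qed

lemma coupled_step_subset:
  assumes G: "pair_graph G" and C: "is_coupling G C" and B: "B \<subseteq> pverts G"
    and step: "coupled_step G C B B'"
  shows "B' \<subseteq> pverts G"
proof -
  interpret G: pair_graph G by (rule G)
  have "coupled_nbhd G C v \<subseteq> pverts G" if "v \<in> pverts G" for v
    using that coupling_partner(2)[OF C] G.in_arcsD2 by (auto simp: coupled_nbhd_def nbhd_def)
  then show ?thesis using step B by (auto elim!: coupled_step.cases)
qed

lemma coupled_steps_iff_loop_steps:
  assumes G: "pair_graph G" and C: "is_coupling G C" and B: "B \<subseteq> pverts G"
  shows "(coupled_step G C)\<^sup>*\<^sup>* B B' \<longleftrightarrow> (loop_step (add_coupling G C))\<^sup>*\<^sup>* B B'"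
proof
  assume "(coupled_step G C)\<^sup>*\<^sup>* B B'"
  then have "(loop_step (add_coupling G C))\<^sup>*\<^sup>* B B' \<and> B' \<subseteq> pverts G"
  proof induction
    case (step B1 B2)
    then show ?case
      using coupled_step_subset[OF G C] coupled_step_iff_loop_step[OF C]
      by (meson rtranclp.rtrancl_into_rtrancl)
  qed (use B in simp)
  then show "(loop_step (add_coupling G C))\<^sup>*\<^sup>* B B'" ..
next
  assume "(loop_step (add_coupling G C))\<^sup>*\<^sup>* B B'"
  then have "(coupled_step G C)\<^sup>*\<^sup>* B B' \<and> B' \<subseteq> pverts G"
  proof induction
    case (step B1 B2)
    then show ?case
      using coupled_step_subset[OF G C] coupled_step_iff_loop_step[OF C]
      by (meson rtranclp.rtrancl_into_rtrancl)
  qed (use B in simp)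
  then show "(coupled_step G C)\<^sup>*\<^sup>* B B'" ..
qed

lemma coupled_zero_forcing_number_eq:
  assumes G: "pair_graph G" and C: "is_coupling G C"
  shows "coupled_zero_forcing_number G C = loop_zero_forcing_number (add_coupling G C)"
proof -
  have "coupled_zero_forcing_set G C = loop_zero_forcing_set (add_coupling G C)"
    using coupled_steps_iff_loop_steps[OF G C]
    by (auto simp: fun_eq_iff coupled_zero_forcing_set_def loop_zero_forcing_set_def
        add_coupling_def)
  then show ?thesis
    by (simp add: coupled_zero_forcing_number_def loop_zero_forcing_number_def)
qed

lemma coupling_perfect_matching:
  assumes C: "is_coupling G C"
  shows "perfect_matching (add_coupling G C) C"
  unfolding perfect_matching_def
proof (intro conjI ballI)
  show "C \<subseteq> edges (add_coupling G C)"
  proof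
    fix e assume "e \<in> C"
    then obtain v where "v \<in> pverts G" "e = {v, partner C v}" using coupling_elem[OF C] by blast
    then show "e \<in> edges (add_coupling G C)" by (auto simp: edges_def add_coupling_def)
  qed
next
  fix v assume "v \<in> pverts (add_coupling G C)"
  then have v: "v \<in> pverts G" by (simp add: add_coupling_def)
  show "\<exists>!e. e \<in> C \<and> v \<in> e"
    using coupling_partner(1)[OF C v] coupling_partner(4)[OF C v] by (intro ex1I) auto
qed

lemma add_coupling_eq_self:
  assumes G: "pair_graph G" and C: "is_coupling G C" and sub: "C \<subseteq> edges G"
  shows "add_coupling G C = G"
proof -
  interpret G: pair_graph G by (rule G)
  have "(v, partner C v) \<in> parcs G" if "v \<in> pverts G" for v
  proof -
    have "{v, partner C v} \<in> edges G" using coupling_partner(1)[OF C that] sub by blast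
    then show ?thesis using G.arcs_symmetric by (auto simp: edges_def doubleton_eq_iff)
  qed
  then have "parcs (add_coupling G C) = parcs G"
    using G.arcs_symmetric by (auto simp: add_coupling_def)
  then show ?thesis by (simp add: add_coupling_def)
qed

theorem theorem6p18:
  fixes G :: "'a pair_pre_digraph"
  assumes "pair_graph G" and "pverts G \<noteq> {}"
  shows
    "(loop_zero_forcing_number G = 1 \<longleftrightarrow> caterpillar G)
   \<and> (\<forall>C. is_coupling G C \<longrightarrow>
        (coupled_zero_forcing_number G C = 1 \<longleftrightarrow>
           caterpillar (add_coupling G C) \<and> (\<exists>M. perfect_matching (add_coupling G C) M)))
   \<and> (\<forall>C. is_coupling G C \<longrightarrow> Digraph_Component.connected (with_proj G) \<longrightarrow>
        (coupled_zero_forcing_number G C = 1 \<longleftrightarrow>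
           caterpillar G \<and> (\<exists>M. perfect_matching G M \<and> C = M)))"
proof -
  have coupled: "coupled_zero_forcing_number G C = 1 \<longleftrightarrow> caterpillar (add_coupling G C)"
    if C: "is_coupling G C" for C
  proof -
    have "pverts (add_coupling G C) \<noteq> {}" using assms(2) by (simp add: add_coupling_def)
    then show ?thesis
      using pair_graph.loop_zero_forcing_number_eq_1_iff[OF pair_graph_add_coupling[OF assms(1) C]]
        coupled_zero_forcing_number_eq[OF assms(1) C] by simp
  qed
  have "coupled_zero_forcing_number G C = 1 \<longleftrightarrow>
          caterpillar G \<and> (\<exists>M. perfect_matching G M \<and> C = M)"
    if C: "is_coupling G C" and conn: "Digraph_Component.connected (with_proj G)" for C
  proof
    assume "coupled_zero_forcing_number G C = 1"
    then have cat: "caterpillar (add_coupling G C)" using coupled[OF C] by simp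
    then have "add_coupling G C = G"
      using connected_spanning_subgraph_of_acyclic[OF assms(1) pair_graph_add_coupling[OF assms(1) C]]
        conn by (auto simp: caterpillar_def undirected_tree_iff add_coupling_def)
    then show "caterpillar G \<and> (\<exists>M. perfect_matching G M \<and> C = M)"
      using cat coupling_perfect_matching[OF C] by simp
  next
    assume "caterpillar G \<and> (\<exists>M. perfect_matching G M \<and> C = M)"
    then show "coupled_zero_forcing_number G C = 1"
      using coupled[OF C] add_coupling_eq_self[OF assms(1) C] by (simp add: perfect_matching_def)
  qed
  then show ?thesis
    using pair_graph.loop_zero_forcing_number_eq_1_iff[OF assms] coupled coupling_perfect_matching
    by blast
qed

end
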